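(* Let $\mathcal{A}$ be a unital semi-prime complex Banach algebra with the inner derivation property, let $n\geq 2$ be an integer, and let $M_{2^n}(\mathcal{A})$ be the algebra of $2^n\times 2^n$-matrices over $\mathcal{A}$. Then any 2-local derivation $\Delta$ on $M_{2^n}(\mathcal{A})$ is a derivation.
   Context: A derivation on an algebra $\mathcal{C}$ is a linear map $D:\mathcal{C}\to\mathcal{C}$ with $D(xy)=D(x)y+xD(y)$ for all $x,y\in\mathcal{C}$ (no continuity is assumed). It is inner if there is $a\in\mathcal{C}$ with $D(x)=\mathrm{ad}(a)(x)=[a,x]=ax-xa$ for all $x\in\mathcal{C}$. The algebra $\mathcal{C}$ has the inner derivation property if every derivation on $\mathcal{C}$ is inner. A map $\Delta:\mathcal{C}\to\mathcal{C}$ (not assumed linear) is a 2-local derivation if for every $x,y\in\mathcal{C}$ there is a derivation $D_{x,y}$ on $\mathcal{C}$ such that $\Delta(x)=D_{x,y}(x)$ and $\Delta(y)=D_{x,y}(y)$. An algebra $\mathcal{A}$ is semi-prime if, for $a\in\mathcal{A}$, $a\mathcal{A}a=0$ implies $a=0$. *)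

theory Defs
  imports "HOL-Analysis.Analysis"
begin

(* Unital complex Banach algebras.  The norm is submultiplicative (from real_normed_algebra);
   norm 1 = 1 is not required. *)
class complex_banach_algebra_1 = real_algebra_1 + real_normed_algebra + banach +
  fixes scaleC :: "complex \<Rightarrow> 'a \<Rightarrow> 'a"
  assumes scaleC_add_right: "scaleC c (x + y) = scaleC c x + scaleC c y"
    and scaleC_add_left: "scaleC (c + d) x = scaleC c x + scaleC d x"
    and scaleC_scaleC: "scaleC c (scaleC d x) = scaleC (c * d) x"
    and scaleC_one: "scaleC 1 x = x"
    and scaleC_of_real: "scaleC (complex_of_real r) x = scaleR r x"
    and mult_scaleC_left: "scaleC c x * y = scaleC c (x * y)"
    and mult_scaleC_right: "x * scaleC c y = scaleC c (x * y)"
    and norm_scaleC: "norm (scaleC c x) = cmod c * norm x"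

definition scaleC_mat ::
    "complex \<Rightarrow> ('a::complex_banach_algebra_1)^'n^'m \<Rightarrow> 'a^'n^'m" where
  "scaleC_mat c X = (\<chi> i j. scaleC c (X $ i $ j))"

(* Below, a complex algebra is given by its scalar multiplication scl and its product mul,
   because the product of square matrices is ( ** ) and not the type class operation ( * ). *)

definition derivation ::
    "(complex \<Rightarrow> 'c \<Rightarrow> 'c) \<Rightarrow> ('c \<Rightarrow> 'c \<Rightarrow> 'c) \<Rightarrow> ('c::ab_group_add \<Rightarrow> 'c) \<Rightarrow> bool" where
  "derivation scl mul D \<longleftrightarrow>
     Vector_Spaces.linear scl scl D \<and> (\<forall>x y. D (mul x y) = mul (D x) y + mul x (D y))"

definition inner_derivation :: "('c \<Rightarrow> 'c \<Rightarrow> 'c) \<Rightarrow> ('c::ab_group_add \<Rightarrow> 'c) \<Rightarrow> bool" where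
  "inner_derivation mul D \<longleftrightarrow> (\<exists>a. \<forall>x. D x = mul a x - mul x a)"

definition inner_derivation_property ::
    "(complex \<Rightarrow> 'c \<Rightarrow> 'c) \<Rightarrow> ('c \<Rightarrow> 'c \<Rightarrow> 'c::ab_group_add) \<Rightarrow> bool" where
  "inner_derivation_property scl mul \<longleftrightarrow>
     (\<forall>D. derivation scl mul D \<longrightarrow> inner_derivation mul D)"

definition two_local_derivation ::
    "(complex \<Rightarrow> 'c \<Rightarrow> 'c) \<Rightarrow> ('c \<Rightarrow> 'c \<Rightarrow> 'c) \<Rightarrow> ('c::ab_group_add \<Rightarrow> 'c) \<Rightarrow> bool" where
  "two_local_derivation scl mul \<Delta> \<longleftrightarrow>
     (\<forall>x y. \<exists>D. derivation scl mul D \<and> \<Delta> x = D x \<and> \<Delta> y = D y)"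

definition semi_prime :: "('c \<Rightarrow> 'c \<Rightarrow> 'c::zero) \<Rightarrow> bool" where
  "semi_prime mul \<longleftrightarrow> (\<forall>a. (\<forall>x. mul (mul a x) a = 0) \<longrightarrow> a = 0)"

(* Vector_Spaces.linear includes the vector space axioms for scl; the next two facts show that
   this part of derivation always holds in the two algebras considered. *)

lemma vector_space_scaleC:
  "vector_space (scaleC :: complex \<Rightarrow> 'a \<Rightarrow> 'a::complex_banach_algebra_1)"
  by unfold_locales (simp_all add: scaleC_add_right scaleC_add_left scaleC_scaleC scaleC_one)

lemma vector_space_scaleC_mat:
  "vector_space (scaleC_mat :: complex \<Rightarrow> ('a::complex_banach_algebra_1)^'n^'m \<Rightarrow> _)"
  by unfold_locales
    (simp_all add: scaleC_mat_def vec_eq_iff scaleC_add_right scaleC_add_left scaleC_scaleC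
      scaleC_one)

end

theory Submission
  imports Defs
begin

text \<open>Every derivation of the matrix algebra is inner, so \<open>\<Delta>\<close> agrees on each pair of matrices with
  some \<open>ad h\<close>. Subtracting a suitable \<open>ad g\<close>, we may assume that \<open>\<Delta>\<close> vanishes at a diagonal matrix
  with distinct integer entries and at the all-ones matrix; then it vanishes at the matrix units,
  and hence at every matrix with central entries. Consequently \<open>\<Delta>\<close> acts on the diagonal entries
  by a single map \<open>\<delta>\<close> of the base algebra, also after conjugation by a matrix with central entries.
  Conjugating by the transvections \<open>1 + e\<^sub>k\<^sub>l\<close> shows that \<open>\<delta>\<close> is additive and that \<open>\<Delta>\<close> is \<open>\<delta>\<close>
  applied entrywise. Comparing \<open>x = a e\<^sub>k\<^sub>l + b e\<^sub>l\<^sub>k\<close> with its square gives the Leibniz rule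
  for \<open>\<delta>\<close>, because the \<open>(k, k)\<close> entry of \<open>x\<^sup>2\<close> is \<open>a b\<close>.\<close>

section \<open>Matrix units and commutators\<close>

lemma matrix_add_rdistrib: "(A + B) ** C = A ** C + B ** C"
  for A B :: "'a::semiring_1^'n^'m" and C :: "'a^'p^'n"
  by (simp add: vec_eq_iff matrix_matrix_mult_def distrib_right sum.distrib)

lemma matrix_diff_ldistrib: "A ** (B - C) = A ** B - A ** C"
  for A :: "'a::ring_1^'n^'m" and B C :: "'a^'p^'n"
  by (simp add: vec_eq_iff matrix_matrix_mult_def right_diff_distrib sum_subtractf)

lemma matrix_diff_rdistrib: "(A - B) ** C = A ** C - B ** C"
  for A B :: "'a::ring_1^'n^'m" and C :: "'a^'p^'n"
  by (simp add: vec_eq_iff matrix_matrix_mult_def left_diff_distrib sum_subtractf)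

definition ad :: "'a::ring_1^'n^'n \<Rightarrow> 'a^'n^'n \<Rightarrow> 'a^'n^'n"
  where "ad h x = h ** x - x ** h"

lemma ad_add_left: "ad (g + h) x = ad g x + ad h x"
  by (simp add: ad_def matrix_add_ldistrib matrix_add_rdistrib)

lemma ad_diff_left: "ad (g - h) x = ad g x - ad h x"
  by (simp add: ad_def matrix_diff_ldistrib matrix_diff_rdistrib)

lemma ad_add_right: "ad h (x + y) = ad h x + ad h y"
  by (simp add: ad_def matrix_add_ldistrib matrix_add_rdistrib)

lemma ad_mult: "ad h (x ** y) = ad h x ** y + x ** ad h y"
  by (simp add: ad_def matrix_diff_ldistrib matrix_diff_rdistrib matrix_mul_assoc)

definition matrix_unit :: "'n \<Rightarrow> 'n \<Rightarrow> 'a::ring_1^'n^'n"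
  where "matrix_unit i j = (\<chi> p q. if p = i \<and> q = j then 1 else 0)"

lemma mult_matrix_unit:
  "(x ** matrix_unit i j) $ p $ q = (if q = j then x $ p $ i else 0)"
proof -
  have "(x ** matrix_unit i j) $ p $ q = (\<Sum>k\<in>UNIV. if k = i then (if q = j then x $ p $ i else 0) else 0)"
    by (auto simp: matrix_matrix_mult_def matrix_unit_def simp del: sum.delta intro!: sum.cong)
  then show ?thesis by simp
qed

lemma matrix_unit_mult:
  "(matrix_unit i j ** x) $ p $ q = (if p = i then x $ j $ q else 0)"
proof -
  have "(matrix_unit i j ** x) $ p $ q = (\<Sum>k\<in>UNIV. if k = j then (if p = i then x $ j $ q else 0) else 0)"
    by (auto simp: matrix_matrix_mult_def matrix_unit_def simp del: sum.delta intro!: sum.cong)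
  then show ?thesis by simp
qed

lemma matrix_unit_mult_matrix_unit:
  "matrix_unit i j ** matrix_unit k l = (if j = k then matrix_unit i l else 0)"
  by (simp add: vec_eq_iff mult_matrix_unit) (auto simp: matrix_unit_def)

lemma matrix_mult_diagonal:
  assumes "\<And>i j. i \<noteq> j \<Longrightarrow> y $ i $ j = 0"
  shows "(x ** y) $ i $ j = x $ i $ j * y $ j $ j" "(y ** x) $ i $ j = y $ i $ i * x $ i $ j"
proof -
  have "(x ** y) $ i $ j = (\<Sum>k\<in>UNIV. if k = j then x $ i $ j * y $ j $ j else 0)"
    "(y ** x) $ i $ j = (\<Sum>k\<in>UNIV. if k = i then y $ i $ i * x $ i $ j else 0)"
    unfolding matrix_matrix_mult_def vec_lambda_beta using assms by (auto intro!: sum.cong simp del: sum.delta)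
  then show "(x ** y) $ i $ j = x $ i $ j * y $ j $ j" "(y ** x) $ i $ j = y $ i $ i * x $ i $ j"
    by simp_all
qed

lemma mat_nth: "mat c $ i $ j = (if i = j then c else 0)"
  by (simp add: mat_def)

lemma mult_mat: "(x ** mat c) $ i $ j = x $ i $ j * c"
  and mat_mult: "(mat c ** x) $ i $ j = c * x $ i $ j"
  for x :: "'a::ring_1^'n^'n"
  by (simp_all add: matrix_mult_diagonal mat_nth)

lemma matrix_unit_mult_mult_matrix_unit:
  "matrix_unit i j ** x ** matrix_unit k l = mat (x $ j $ k) ** matrix_unit i l"
  by (simp add: vec_eq_iff mult_matrix_unit matrix_unit_mult mat_nth)

text \<open>Entry (i, k) of the relation for e_jk determines x_ij.\<close>

lemma commutes_matrix_units_imp_mat: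
  assumes "\<And>i j. x ** matrix_unit i j = matrix_unit i j ** x"
  shows "x = mat (x $ k $ k)"
proof -
  have "x $ i $ j = (if i = j then x $ k $ k else 0)" for i j
  proof -
    have "(x ** matrix_unit j k) $ i $ k = (matrix_unit j k ** x) $ i $ k"
      by (simp only: assms)
    then show ?thesis by (simp only: mult_matrix_unit matrix_unit_mult if_True simp_thms)
  qed
  then show ?thesis unfolding vec_eq_iff mat_nth by blast
qed

section \<open>Derivations of matrix algebras\<close>

lemma derivation_mat_iff:
  "derivation scaleC_mat (**) D \<longleftrightarrow> (\<forall>x y. D (x + y) = D x + D y) \<and>
     (\<forall>c x. D (scaleC_mat c x) = scaleC_mat c (D x)) \<and> (\<forall>x y. D (x ** y) = D x ** y + x ** D y)"
  for D :: "('a::complex_banach_algebra_1)^'m^'m \<Rightarrow> 'a^'m^'m"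
  using vector_space_scaleC_mat
  by (auto simp: derivation_def Vector_Spaces.linear_iff)

lemma derivation_iff:
  "derivation scaleC (*) D \<longleftrightarrow> (\<forall>x y. D (x + y) = D x + D y) \<and>
     (\<forall>c x. D (scaleC c x) = scaleC c (D x)) \<and> (\<forall>x y. D (x * y) = D x * y + x * D y)"
  for D :: "'a::complex_banach_algebra_1 \<Rightarrow> 'a"
  using vector_space_scaleC
  by (auto simp: derivation_def Vector_Spaces.linear_iff)

lemma derivation_ad:
  fixes h :: "('a::complex_banach_algebra_1)^'m^'m"
  shows "derivation scaleC_mat (**) (ad h)"
proof -
  have scaleC_0: "scaleC c 0 = (0::'a)" for c
    using scaleC_add_right[of c 0 0] by simp
  have scaleC_sum: "scaleC c (sum f A) = (\<Sum>i\<in>A. scaleC c (f i :: 'a))" for c f and A :: "'m set"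
    by (induction A rule: infinite_finite_induct) (simp_all add: scaleC_0 scaleC_add_right)
  have scaleC_diff: "scaleC c (a - b) = scaleC c a - scaleC c (b::'a)" for c a b
    using scaleC_add_right[of c "a - b" b] by (simp add: algebra_simps)
  have "ad h (scaleC_mat c x) = scaleC_mat c (ad h x)" for c x
    by (simp add: vec_eq_iff ad_def scaleC_mat_def matrix_matrix_mult_def scaleC_sum scaleC_diff
        mult_scaleC_left mult_scaleC_right)
  then show ?thesis
    unfolding derivation_mat_iff by (simp add: ad_add_right ad_mult)
qed

text \<open>Subtracting \<open>ad h\<close> leaves a derivation that kills all matrix units, hence
  acts entrywise by a derivation of the base algebra; that one is inner by hypothesis.\<close>

lemma derivation_mat_inner:
  fixes D :: "('a::complex_banach_algebra_1)^'m^'m \<Rightarrow> 'a^'m^'m"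
  assumes "inner_derivation_property (scaleC :: complex \<Rightarrow> 'a \<Rightarrow> 'a) (*)"
    and D: "derivation scaleC_mat (**) D"
  obtains h where "D = ad h"
proof -
  let ?k = "undefined :: 'm"
  \<comment> \<open>This is the sum over j of D(e_jk) e_kj, with k the arbitrary index
    \<open>?k\<close>.\<close>
  define h :: "'a^'m^'m" where "h = (\<chi> i j. D (matrix_unit j ?k) $ i $ ?k)"
  have D_add: "D (x + y) = D x + D y" and D_mult: "D (x ** y) = D x ** y + x ** D y" for x y
    using D by (simp_all add: derivation_mat_iff)
  have D_0: "D 0 = 0" using D_add[of 0 0] by simp
  have D_unit: "D (matrix_unit i j) = ad h (matrix_unit i j)" for i j
  proof -
    \<comment> \<open>Leibniz rule for e_ij e_qk, read at entry (p, k).\<close>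
    have "D (matrix_unit i j) $ p $ q = ad h (matrix_unit i j) $ p $ q" for p q
      using arg_cong[OF D_mult[of "matrix_unit i j" "matrix_unit q ?k"], of "\<lambda>y. y $ p $ ?k"]
      by (auto simp: ad_def h_def mult_matrix_unit matrix_unit_mult matrix_unit_mult_matrix_unit D_0
          algebra_simps split: if_splits)
    then show ?thesis by (simp add: vec_eq_iff)
  qed
  define D' where "D' x = D x - ad h x" for x
  have D'_add: "D' (x + y) = D' x + D' y" for x y
    by (simp add: D'_def D_add ad_add_right)
  have D'_mult: "D' (x ** y) = D' x ** y + x ** D' y" for x y
    by (simp add: D'_def D_mult ad_mult matrix_diff_ldistrib matrix_diff_rdistrib)
  have D'_scale: "D' (scaleC_mat c x) = scaleC_mat c (D' x)" for c x
  proof -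
    have "D' (scaleC_mat c x) = scaleC_mat c (D x) - scaleC_mat c (ad h x)"
      using D derivation_ad[of h] by (simp add: D'_def derivation_mat_iff)
    also have "\<dots> = scaleC_mat c (D' x)"
      unfolding D'_def by (rule module.scale_right_diff_distrib[symmetric])
        (rule vector_space_scaleC_mat[unfolded module_iff_vector_space[symmetric]])
    finally show ?thesis .
  qed
  have D'_unit: "D' (matrix_unit i j) = 0" for i j
    by (simp add: D'_def D_unit)
  define d where "d a = D' (mat a) $ ?k $ ?k" for a
  have D'_mat: "D' (mat a) = mat (d a)" for a
    unfolding d_def
  proof (rule commutes_matrix_units_imp_mat)
    fix i j :: 'm
    \<comment> \<open>Since \<open>D'\<close> kills the units, applying it to this relation shows
      that \<open>D' (mat a)\<close> commutes with them too.\<close>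
    have "mat a ** matrix_unit i j = matrix_unit i j ** mat a"
      by (simp add: vec_eq_iff mult_mat mat_mult) (simp add: matrix_unit_def)
    then have "D' (mat a ** matrix_unit i j) = D' (matrix_unit i j ** mat a)" by simp
    then show "D' (mat a) ** matrix_unit i j = matrix_unit i j ** D' (mat a)"
      by (simp add: D'_mult D'_unit)
  qed
  have D'_nth: "D' x $ i $ j = d (x $ i $ j)" for x i j
  proof -
    \<comment> \<open>Cutting with units isolates one entry: e_ii x e_jj is x_ij e_ij.\<close>
    have "matrix_unit i i ** D' x ** matrix_unit j j = D' (matrix_unit i i ** x ** matrix_unit j j)"
      by (simp add: D'_mult D'_unit)
    also have "\<dots> = mat (d (x $ i $ j)) ** matrix_unit i j"
      by (simp add: matrix_unit_mult_mult_matrix_unit D'_mult D'_unit D'_mat)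
    finally have "(matrix_unit i i ** D' x ** matrix_unit j j) $ i $ j =
        (mat (d (x $ i $ j)) ** matrix_unit i j) $ i $ j"
      by simp
    then show ?thesis
      by (simp add: matrix_unit_mult mult_matrix_unit mat_nth)
  qed
  have "derivation scaleC (*) d"
    unfolding derivation_iff
  proof (intro conjI allI)
    fix a b c
    show "d (a + b) = d a + d b"
      using D'_add[of "mat a" "mat b"] D'_nth[of _ ?k ?k]
      by (metis mat_nth vector_add_component)
    show "d (a * b) = d a * b + a * d b"
      using arg_cong[OF D'_mult[of "mat a" "mat b"], of "\<lambda>y. y $ ?k $ ?k"]
      by (simp add: D'_nth mat_mult mult_mat mat_nth)
    show "d (scaleC c a) = scaleC c (d a)"
      using arg_cong[OF D'_scale[of c "mat a"], of "\<lambda>y. y $ ?k $ ?k"]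
      by (simp add: D'_nth scaleC_mat_def mat_nth)
  qed
  then obtain c where c: "d a = c * a - a * c" for a
    using assms(1) unfolding inner_derivation_property_def inner_derivation_def by blast
  have "D x = ad (h + mat c) x" for x
  proof -
    have "D' x = ad (mat c) x"
      by (simp add: vec_eq_iff D'_nth c ad_def mult_mat mat_mult)
    then show ?thesis by (simp add: D'_def ad_add_left algebra_simps)
  qed
  then show ?thesis using that by blast
qed

section \<open>Maps that agree with inner derivations on pairs\<close>

definition two_local_inner :: "('a::ring_1^'n^'n \<Rightarrow> 'a^'n^'n) \<Rightarrow> bool"
  where "two_local_inner \<Delta> \<longleftrightarrow> (\<forall>x y. \<exists>h. \<Delta> x = ad h x \<and> \<Delta> y = ad h y)"

lemma two_local_innerE:
  assumes "two_local_inner \<Delta>"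
  obtains h where "\<Delta> x = ad h x" "\<Delta> y = ad h y"
  using assms unfolding two_local_inner_def by blast

lemma two_local_inner_diff_ad:
  fixes \<Delta> :: "'a::ring_1^'n^'n \<Rightarrow> 'a^'n^'n"
  assumes "two_local_inner \<Delta>"
  shows "two_local_inner (\<lambda>x. \<Delta> x - ad g x)"
  unfolding two_local_inner_def
proof (intro allI)
  fix x y :: "'a^'n^'n"
  from two_local_innerE[OF assms] obtain h where "\<Delta> x = ad h x" "\<Delta> y = ad h y" .
  then show "\<exists>h. \<Delta> x - ad g x = ad h x \<and> \<Delta> y - ad g y = ad h y"
    by (intro exI[of _ "h - g"]) (simp add: ad_diff_left)
qed

section \<open>Normalisation: vanishing at matrix units and central matrices\<close>

definition index_matrix :: "'a::real_algebra_1^'n::finite^'n"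
  where "index_matrix = (\<chi> i j. if i = j then of_nat (to_nat i) else 0)"

text \<open>The (i, j) entry of the commutator is h_ij times a difference of distinct integers, as
  \<open>to_nat\<close> is injective; this is a nonzero real factor.\<close>

lemma commutes_index_matrix_imp_diagonal:
  fixes h :: "'a::real_algebra_1^'n::finite^'n"
  assumes "ad h index_matrix = 0" "i \<noteq> j"
  shows "h $ i $ j = 0"
proof -
  have "ad h index_matrix $ i $ j = h $ i $ j * of_nat (to_nat j) - of_nat (to_nat i) * h $ i $ j"
    by (simp add: ad_def matrix_mult_diagonal index_matrix_def)
  also have "\<dots> = (real (to_nat j) - real (to_nat i)) *\<^sub>R h $ i $ j"
    by (simp add: scaleR_conv_of_real algebra_simps mult_of_nat_commute)
  finally have "(real (to_nat j) - real (to_nat i)) *\<^sub>R h $ i $ j = 0"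
    using assms(1) by simp
  with \<open>i \<noteq> j\<close> show ?thesis by simp
qed

text \<open>Pairing e_ij with \<open>index_matrix\<close> gives a diagonal \<open>h\<close>, so only
  entry (i, j) of the image can survive. Pairing with the all-ones matrix kills that entry, which is
  g_ii - g_jj.\<close>

lemma vanishes_on_matrix_units:
  fixes \<Delta> :: "'a::real_algebra_1^'n::finite^'n \<Rightarrow> 'a^'n^'n"
  assumes "two_local_inner \<Delta>" "\<Delta> index_matrix = 0" "\<Delta> (\<chi> i j. 1) = 0"
  shows "\<Delta> (matrix_unit i j) = 0"
proof -
  let ?e = "matrix_unit i j :: 'a^'n^'n"
  from two_local_innerE[OF assms(1)] obtain h
    where h: "\<Delta> ?e = ad h ?e" "\<Delta> index_matrix = ad h index_matrix" .
  from two_local_innerE[OF assms(1)] obtain g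
    where g: "\<Delta> ?e = ad g ?e" "\<Delta> (\<chi> i j. 1) = ad g (\<chi> i j. 1)" .
  have ad_unit: "ad x ?e $ p $ q = (if q = j then x $ p $ i else 0) - (if p = i then x $ j $ q else 0)" for x p q
    by (simp add: ad_def mult_matrix_unit matrix_unit_mult)
  have diag: "h $ p $ q = 0" if "p \<noteq> q" for p q
    using commutes_index_matrix_imp_diagonal that h(2) assms(2) by metis
  have off: "\<Delta> ?e $ p $ q = 0" if "p \<noteq> i \<or> q \<noteq> j" for p q
    using that diag unfolding h(1) ad_unit by auto
  have "\<Delta> ?e $ i $ j = 0"
  proof (cases "i = j")
    case True
    then show ?thesis unfolding h(1) ad_unit by simp
  next
    case False
    \<comment> \<open>\<open>g\<close> implements the same value at e_ij, so column i and row j of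
      \<open>g\<close> vanish off the diagonal. The sums in entry (j, i) of the second commutator
      then collapse to g_jj and g_ii.\<close>
    have "g $ p $ i = 0" if "p \<noteq> i" for p
      using off[of p j] that False unfolding g(1) ad_unit by simp
    then have col: "(\<Sum>p\<in>UNIV. g $ p $ i) = g $ i $ i"
      by (subst sum.remove[of _ i]) auto
    have "g $ j $ q = 0" if "q \<noteq> j" for q
      using off[of i q] that False unfolding g(1) ad_unit by simp
    then have row: "(\<Sum>q\<in>UNIV. g $ j $ q) = g $ j $ j"
      by (subst sum.remove[of _ j]) auto
    have "ad g (\<chi> i j. 1) $ j $ i = 0" using g(2) assms(3) by simp
    then have "g $ j $ j = g $ i $ i"
      by (simp add: ad_def matrix_matrix_mult_def col row)
    then show ?thesis by (simp add: g(1) ad_unit)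
  qed
  with off show ?thesis by (simp add: vec_eq_iff) metis
qed

definition central_matrix :: "'a::ring_1^'n^'n \<Rightarrow> bool"
  where "central_matrix S \<longleftrightarrow> (\<forall>c. S ** mat c = mat c ** S)"

lemma central_matrix_iff: "central_matrix S \<longleftrightarrow> (\<forall>i j c. S $ i $ j * c = c * S $ i $ j)"
  by (auto simp: central_matrix_def vec_eq_iff mult_mat mat_mult)

lemma central_matrix_mult: "central_matrix S \<Longrightarrow> central_matrix T \<Longrightarrow> central_matrix (S ** T)"
  unfolding central_matrix_def by (metis matrix_mul_assoc)

text \<open>With e = e_ij and s = S_ji we have e S e = s e. As s is central, \<open>ad h\<close>
  kills both factors on the right, so e (\<open>ad h S\<close>) e = 0, which isolates entry (j,
  i).\<close>

lemma vanishes_on_central_matrices: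
  assumes "two_local_inner \<Delta>" and "\<And>i j. \<Delta> (matrix_unit i j) = 0" and "central_matrix S"
  shows "\<Delta> S = 0"
proof -
  have "\<Delta> S $ j $ i = 0" for i j
  proof -
    let ?e = "matrix_unit i j" and ?s = "S $ j $ i"
    from two_local_innerE[OF assms(1)] obtain h
      where h: "\<Delta> S = ad h S" "\<Delta> ?e = ad h ?e" .
    have "ad h (mat ?s) = 0"
      using assms(3) by (simp add: central_matrix_iff vec_eq_iff ad_def mult_mat mat_mult)
    then have "ad h (?e ** S ** ?e) = 0"
      using h(2) assms(2) by (simp add: matrix_unit_mult_mult_matrix_unit ad_mult)
    then have "?e ** \<Delta> S ** ?e = 0"
      using h assms(2) by (simp add: ad_mult)
    then have "(?e ** \<Delta> S ** ?e) $ i $ j = 0" by simp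
    then show ?thesis by (simp add: mult_matrix_unit matrix_unit_mult)
  qed
  then show ?thesis by (simp add: vec_eq_iff)
qed

text \<open>Vanishing is required at all central matrices, not just at the units, because this
  visibly passes to conjugates by central matrices with central inverse.\<close>

locale central_two_local_inner =
  fixes \<Delta> :: "'a::{real_algebra_1,real_normed_algebra}^'n::finite^'n \<Rightarrow> 'a^'n^'n"
  assumes two_local: "two_local_inner \<Delta>"
    and central: "central_matrix S \<Longrightarrow> \<Delta> S = 0"
begin

section \<open>The map induced on entries\<close>

definition entry_map :: "'a \<Rightarrow> 'a"
  where "entry_map a = \<Delta> (mat a) $ undefined $ undefined"

text \<open>Scalar matrices commute with the units, and this survives \<open>\<Delta>\<close>. So
  the index \<open>undefined\<close> in \<open>entry_map\<close> stands for any index.\<close>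

lemma mat_entry_map: "\<Delta> (mat a) = mat (entry_map a)"
  unfolding entry_map_def
proof (rule commutes_matrix_units_imp_mat)
  fix i j :: 'n
  let ?e = "matrix_unit i j :: 'a^'n^'n"
  from two_local_innerE[OF two_local] obtain h
    where h: "\<Delta> (mat a) = ad h (mat a)" "\<Delta> ?e = ad h ?e" .
  have "\<Delta> ?e = 0"
    by (rule central) (simp add: central_matrix_iff matrix_unit_def)
  then have e: "ad h ?e = 0" using h by simp
  have "mat a ** ?e = ?e ** mat a"
    by (simp add: vec_eq_iff mult_mat mat_mult) (simp add: matrix_unit_def)
  then have "ad h (mat a ** ?e) = ad h (?e ** mat a)" by simp
  then show "\<Delta> (mat a) ** ?e = ?e ** \<Delta> (mat a)"
    by (simp add: ad_mult e h(1))
qed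

text \<open>Real scalars are central, so every \<open>ad h\<close> ignores them. This permits
  shifting diagonal entries apart below.\<close>

lemma entry_map_add_of_real: "entry_map (a + of_real r) = entry_map a"
proof -
  from two_local_innerE[OF two_local] obtain h
    where h: "\<Delta> (mat a) = ad h (mat a)" "\<Delta> (mat (a + of_real r)) = ad h (mat (a + of_real r))" .
  have "ad h (mat (a + of_real r)) = ad h (mat a)"
    by (simp add: vec_eq_iff ad_def mult_mat mat_mult algebra_simps) (simp add: of_real_def)
  then have "mat (entry_map (a + of_real r)) $ i $ i = mat (entry_map a) $ i $ i" for i :: 'n
    using h by (simp add: mat_entry_map)
  then show ?thesis by (simp add: mat_nth)
qed

text \<open>At (i, i), a commutator with y sees only y_ii, so y may be paired with a scalar matrix.
  Off the diagonal, pairing with \<open>index_matrix\<close> gives h_ij = 0.\<close>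

lemma diagonal:
  assumes y: "\<And>i j. i \<noteq> j \<Longrightarrow> y $ i $ j = 0"
  shows "\<Delta> y $ i $ j = (if i = j then entry_map (y $ i $ i) else 0)"
proof (cases "i = j")
  case True
  from two_local_innerE[OF two_local] obtain h
    where h: "\<Delta> y = ad h y" "\<Delta> (mat (y $ i $ i)) = ad h (mat (y $ i $ i))" .
  have "\<Delta> y $ i $ i = \<Delta> (mat (y $ i $ i)) $ i $ i"
    unfolding h by (simp add: ad_def mult_mat mat_mult matrix_mult_diagonal[OF y])
  with True show ?thesis by (simp add: mat_entry_map mat_nth)
next
  case False
  from two_local_innerE[OF two_local] obtain h
    where h: "\<Delta> y = ad h y" "\<Delta> index_matrix = ad h index_matrix" .
  have "\<Delta> index_matrix = 0"
    by (rule central) (simp add: central_matrix_iff index_matrix_def mult_of_nat_commute)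
  then have "h $ i $ j = 0"
    using commutes_index_matrix_imp_diagonal h(2) False by metis
  with False show ?thesis
    unfolding h(1) by (simp add: ad_def matrix_mult_diagonal[OF y])
qed

text \<open>Pairing \<open>x\<close> with a diagonal matrix whose entries are those of \<open>x\<close>, shifted by scalars that
  lie far apart, forces the implementing matrix to be diagonal: its \<open>(i, j)\<close> entry intertwines two
  elements with disjoint spectra.\<close>

lemma diagonal_entry: "\<Delta> x $ i $ i = entry_map (x $ i $ i)"
proof -
  define B where "B = (\<Sum>i\<in>UNIV. norm (x $ i $ i))"
  have B: "norm (x $ i $ i) \<le> B" for i
    unfolding B_def by (rule member_le_sum) auto
  have "B \<ge> 0" unfolding B_def by (simp add: sum_nonneg)
  \<comment> \<open>The gaps must exceed 2B, which bounds the sum of the norms of any two diagonal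
    entries.\<close>
  define r where "r i = (2 * B + 1) * real (to_nat i)" for i :: 'n
  have r: "\<bar>r i - r j\<bar> > 2 * B" if "i \<noteq> j" for i j
  proof -
    have "to_nat i \<noteq> to_nat j" using that by simp
    then have "\<bar>real (to_nat i) - real (to_nat j)\<bar> \<ge> 1" by linarith
    then have "(2 * B + 1) * \<bar>real (to_nat i) - real (to_nat j)\<bar> \<ge> (2 * B + 1) * 1"
      using \<open>B \<ge> 0\<close> by (intro mult_left_mono) auto
    moreover have "\<bar>r i - r j\<bar> = (2 * B + 1) * \<bar>real (to_nat i) - real (to_nat j)\<bar>"
      using \<open>B \<ge> 0\<close> by (simp add: r_def abs_mult flip: right_diff_distrib)
    ultimately have "\<bar>r i - r j\<bar> \<ge> 2 * B + 1" by (simp only: mult_1_right)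
    then show ?thesis by linarith
  qed
  define y :: "'a^'n^'n" where "y = (\<chi> i j. if i = j then x $ i $ i + of_real (r i) else 0)"
  have y: "y $ i $ j = (if i = j then x $ i $ i + of_real (r i) else 0)" for i j
    by (simp add: y_def)
  have y_diag: "i \<noteq> j \<Longrightarrow> y $ i $ j = 0" for i j by (simp add: y)
  from two_local_innerE[OF two_local] obtain h where h: "\<Delta> x = ad h x" "\<Delta> y = ad h y" .
  have h_diag: "h $ i $ j = 0" if "i \<noteq> j" for i j
  proof (rule ccontr)
    assume nz: "h $ i $ j \<noteq> 0"
    have "ad h y $ i $ j = 0"
      using diagonal[OF y_diag, of i j] that h(2) by simp
    then have "h $ i $ j * (x $ j $ j + of_real (r j)) = (x $ i $ i + of_real (r i)) * h $ i $ j"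
      by (simp add: ad_def matrix_mult_diagonal[OF y_diag]) (simp add: y)
    then have "(r j - r i) *\<^sub>R h $ i $ j = x $ i $ i * h $ i $ j - h $ i $ j * x $ j $ j"
      by (simp add: algebra_simps of_real_def)
    then have "\<bar>r j - r i\<bar> * norm (h $ i $ j) = norm (x $ i $ i * h $ i $ j - h $ i $ j * x $ j $ j)"
      by (metis norm_scaleR)
    also have "\<dots> \<le> norm (x $ i $ i) * norm (h $ i $ j) + norm (h $ i $ j) * norm (x $ j $ j)"
      by (intro norm_triangle_le_diff add_mono norm_mult_ineq)
    also have "\<dots> \<le> B * norm (h $ i $ j) + norm (h $ i $ j) * B"
      by (intro add_mono mult_left_mono mult_right_mono B) auto
    also have "\<dots> = (2 * B) * norm (h $ i $ j)" by simp
    finally have "\<bar>r j - r i\<bar> \<le> 2 * B" using nz by simp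
    with r[of j i] that show False by simp
  qed
  have "\<Delta> x $ i $ i = h $ i $ i * x $ i $ i - x $ i $ i * h $ i $ i"
    by (simp add: h(1) ad_def matrix_mult_diagonal[OF h_diag])
  \<comment> \<open>The shift by a real scalar cancels in the commutator.\<close>
  also have "\<dots> = ad h y $ i $ i"
    by (simp add: ad_def matrix_mult_diagonal[OF y_diag]) (simp add: y algebra_simps of_real_def)
  also have "\<dots> = entry_map (x $ i $ i)"
    using diagonal[OF y_diag, of i i] h(2) by (simp add: y entry_map_add_of_real)
  finally show ?thesis .
qed

text \<open>The conjugate of \<open>\<Delta>\<close> is a map of the same kind with the same \<open>entry_map\<close>.\<close>

lemma conjugate_diagonal_entry:
  assumes S: "central_matrix S" and T: "central_matrix T"
    and ST: "S ** T = mat 1" and TS: "T ** S = mat 1"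
  shows "(T ** \<Delta> z ** S) $ i $ i = entry_map ((T ** z ** S) $ i $ i)"
proof -
  define \<Delta>' where "\<Delta>' x = T ** \<Delta> (S ** x ** T) ** S" for x
  have cancel: "T ** (S ** x) = x" "S ** (T ** x) = x" for x
    by (simp_all add: matrix_mul_assoc ST TS)
  interpret conj: central_two_local_inner \<Delta>'
  proof
    show "two_local_inner \<Delta>'"
      unfolding two_local_inner_def
    proof (intro allI)
      fix x y :: "'a^'n^'n"
      from two_local_innerE[OF two_local] obtain h
        where h: "\<Delta> (S ** x ** T) = ad h (S ** x ** T)" "\<Delta> (S ** y ** T) = ad h (S ** y ** T)" .
      have "T ** ad h (S ** x ** T) ** S = ad (T ** h ** S) x"
        for x :: "'a^'n^'n"
        by (simp add: ad_def matrix_diff_ldistrib matrix_diff_rdistrib cancel TS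
            flip: matrix_mul_assoc)
      with h show "\<exists>h. \<Delta>' x = ad h x \<and> \<Delta>' y = ad h y" by (auto simp: \<Delta>'_def)
    qed
    show "\<Delta>' R = 0" if "central_matrix R" for R
      using that by (simp add: \<Delta>'_def central central_matrix_mult S T)
  qed
  \<comment> \<open>\<open>S\<close> and \<open>T\<close> commute with scalar matrices, so
    conjugation fixes these and \<open>entry_map\<close> is unchanged.\<close>
  have "\<Delta>' (mat a) = \<Delta> (mat a)" for a
  proof -
    have "S ** mat a ** T = mat a"
      using S by (metis ST central_matrix_def matrix_mul_assoc matrix_mul_rid)
    moreover have "T ** mat b ** S = mat b" for b
      using T by (metis TS central_matrix_def matrix_mul_assoc matrix_mul_rid)
    ultimately show ?thesis by (simp add: \<Delta>'_def mat_entry_map)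
  qed
  then have "conj.entry_map a = entry_map a" for a
    by (simp add: entry_map_def conj.entry_map_def)
  moreover have "S ** (T ** z ** S) ** T = z"
    by (simp add: cancel ST flip: matrix_mul_assoc)
  ultimately show ?thesis
    using conj.diagonal_entry[of "T ** z ** S" i] by (simp add: \<Delta>'_def)
qed

text \<open>Conjugation by 1 + e_kl mixes the (l, k) entry into the diagonal entries at k and l, for
  z and for its image alike; on diagonal entries the action of \<open>\<Delta>\<close> is already
  known.\<close>

lemma transvection_entries:
  assumes "k \<noteq> l"
  shows "entry_map (z $ k $ k - z $ l $ k) = entry_map (z $ k $ k) - \<Delta> z $ l $ k"
    and "entry_map (z $ l $ l + z $ l $ k) = entry_map (z $ l $ l) + \<Delta> z $ l $ k"
proof -
  define S T :: "'a^'n^'n" where "S = mat 1 + matrix_unit k l" and "T = mat 1 - matrix_unit k l"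
  have unit: "matrix_unit k l ** matrix_unit k l = (0 :: 'a^'n^'n)"
    using assms by (simp add: matrix_unit_mult_matrix_unit)
  have ST: "S ** T = mat 1" "T ** S = mat 1"
    by (simp_all add: S_def T_def matrix_add_ldistrib matrix_add_rdistrib matrix_diff_ldistrib
        matrix_diff_rdistrib unit)
  have "central_matrix S" "central_matrix T"
    using assms by (auto simp: central_matrix_iff S_def T_def mat_nth matrix_unit_def)
  note conj = conjugate_diagonal_entry[OF this ST, of z]
  have "(T ** x ** S) $ k $ k = x $ k $ k - x $ l $ k"
    and "(T ** x ** S) $ l $ l = x $ l $ l + x $ l $ k" for x
    using assms by (simp_all add: S_def T_def matrix_add_ldistrib matrix_diff_rdistrib
        mult_matrix_unit matrix_unit_mult)
  with conj[of k] conj[of l]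
  show "entry_map (z $ k $ k - z $ l $ k) = entry_map (z $ k $ k) - \<Delta> z $ l $ k"
    and "entry_map (z $ l $ l + z $ l $ k) = entry_map (z $ l $ l) + \<Delta> z $ l $ k"
    by (simp_all add: diagonal_entry)
qed

lemma entry_map_0: "entry_map 0 = 0"
  using central[of "mat 0"] by (simp add: entry_map_def central_matrix_iff)

text \<open>The first transvection identity does not involve z_ll, so that entry may be set to 0
  without changing the image at (l, k). The second identity then gives the value.\<close>

lemma off_diagonal_entry:
  assumes "k \<noteq> l"
  shows "\<Delta> z $ l $ k = entry_map (z $ l $ k)"
proof -
  define w :: "'a^'n^'n" where "w = (\<chi> i j. if i = l \<and> j = l then 0 else z $ i $ j)"
  have w: "w $ l $ l = 0" "w $ k $ k = z $ k $ k" "w $ l $ k = z $ l $ k"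
    using assms by (simp_all add: w_def)
  have "\<Delta> z $ l $ k = \<Delta> w $ l $ k"
    using transvection_entries(1)[OF assms, of z] transvection_entries(1)[OF assms, of w] by (simp add: w)
  also have "\<dots> = entry_map (z $ l $ k)"
    using transvection_entries(2)[OF assms, of w] by (simp add: w entry_map_0)
  finally show ?thesis .
qed

lemma entrywise: "\<Delta> z $ i $ j = entry_map (z $ i $ j)"
  using diagonal_entry off_diagonal_entry by (cases "i = j") auto

text \<open>The matrix used has a at (l, l) and b at (l, k).\<close>

lemma entry_map_add:
  assumes "k \<noteq> (l :: 'n)"
  shows "entry_map (a + b) = entry_map a + entry_map b"
  using transvection_entries(2)[OF assms, of "\<chi> i j. if j = l then a else b"] assms
  by (simp add: entrywise)

lemma entry_map_mult:
  assumes "k \<noteq> (l :: 'n)"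
  shows "entry_map (a * b) = entry_map a * b + a * entry_map b"
proof -
  define x :: "'a^'n^'n" where "x = mat a ** matrix_unit k l + mat b ** matrix_unit l k"
  have x: "x $ i $ j = (if i = k \<and> j = l then a else if i = l \<and> j = k then b else 0)" for i j
    using assms by (simp add: x_def mat_mult) (simp add: matrix_unit_def)
  have right: "(x ** y) $ k $ k = a * y $ l $ k" for y
    using assms by (simp add: x_def matrix_add_rdistrib mat_mult matrix_unit_mult flip: matrix_mul_assoc)
  have left: "(y ** x) $ k $ k = y $ k $ l * b" for y
  proof -
    have "(y ** x) $ k $ k = (\<Sum>j\<in>UNIV. if j = l then y $ k $ l * b else 0)"
      unfolding matrix_matrix_mult_def using assms by (auto simp: x intro!: sum.cong simp del: sum.delta)
    then show ?thesis by simp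
  qed
  \<comment> \<open>One \<open>h\<close> serves both x and its square, so the product rule of
    \<open>ad h\<close> becomes one for \<open>\<Delta>\<close>.\<close>
  from two_local_innerE[OF two_local] obtain h where h: "\<Delta> x = ad h x" "\<Delta> (x ** x) = ad h (x ** x)" .
  have "\<Delta> (x ** x) = \<Delta> x ** x + x ** \<Delta> x"
    by (simp add: h ad_mult)
  then have "\<Delta> (x ** x) $ k $ k = (\<Delta> x ** x + x ** \<Delta> x) $ k $ k" by simp
  then show ?thesis
    using assms by (simp add: entrywise right left x)
qed

end

section \<open>Two-local derivations\<close>

lemma derivation_mat_add:
  assumes "derivation scaleC_mat (**) D" "derivation scaleC_mat (**) (D' :: ('a::complex_banach_algebra_1)^'m^'m \<Rightarrow> _)"
  shows "derivation scaleC_mat (**) (\<lambda>x. D x + D' x)"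
  using assms unfolding derivation_mat_iff
  by (simp add: matrix_add_ldistrib matrix_add_rdistrib module.scale_right_distrib
      vector_space_scaleC_mat[unfolded module_iff_vector_space[symmetric]])

theorem theorem2p1:
  fixes \<Delta> :: "('a::complex_banach_algebra_1)^'m^'m \<Rightarrow> 'a^'m^'m"
    and n :: nat
  assumes "semi_prime ((*) :: 'a \<Rightarrow> 'a \<Rightarrow> 'a)"
    and "inner_derivation_property (scaleC :: complex \<Rightarrow> 'a \<Rightarrow> 'a) (*)"
    and "n \<ge> 2"
    and "CARD('m) = 2 ^ n"
    and "two_local_derivation scaleC_mat (**) \<Delta>"
  shows "derivation scaleC_mat (**) \<Delta>"
proof -
  \<comment> \<open>The order is at least 4, which provides two distinct indices.\<close>
  have "\<not> CARD('m) \<le> Suc 0"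
    using power_increasing[OF assms(3), of "2::nat"] by (simp add: assms(4))
  then obtain k l :: 'm where kl: "k \<noteq> l"
    by (auto simp: card_le_Suc0_iff_eq)
  have "two_local_inner \<Delta>"
    unfolding two_local_inner_def
  proof (intro allI)
    fix x y
    obtain D where D: "derivation scaleC_mat (**) D" "\<Delta> x = D x" "\<Delta> y = D y"
      using assms(5) unfolding two_local_derivation_def by blast
    from derivation_mat_inner[OF assms(2) D(1)] obtain h where "D = ad h" .
    with D show "\<exists>h. \<Delta> x = ad h x \<and> \<Delta> y = ad h y" by auto
  qed
  then obtain g where g: "\<Delta> index_matrix = ad g index_matrix"
      "\<Delta> (\<chi> i j. 1) = ad g (\<chi> i j. 1)"
    by (rule two_local_innerE)
  define \<Delta>' where "\<Delta>' x = \<Delta> x - ad g x" for x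
  have inner: "two_local_inner \<Delta>'"
    unfolding \<Delta>'_def by (rule two_local_inner_diff_ad) fact
  have "\<Delta>' index_matrix = 0" "\<Delta>' (\<chi> i j. 1) = 0"
    by (simp_all add: \<Delta>'_def g)
  with inner have unit: "\<Delta>' (matrix_unit i j) = 0" for i j
    by (rule vanishes_on_matrix_units)
  interpret central_two_local_inner \<Delta>'
    by unfold_locales (fact inner, erule vanishes_on_central_matrices[OF inner unit])
  note add = entry_map_add[OF kl] and mult = entry_map_mult[OF kl]
  have entry_map_sum: "entry_map (sum f A) = (\<Sum>i\<in>A. entry_map (f i))" for f and A :: "'m set"
    by (induction A rule: infinite_finite_induct) (simp_all add: entry_map_0 add)
  have "derivation scaleC_mat (**) \<Delta>'"
    unfolding derivation_mat_iff
  proof (intro conjI allI)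
    fix x y :: "'a^'m^'m" and c
    show "\<Delta>' (x + y) = \<Delta>' x + \<Delta>' y"
      by (simp add: vec_eq_iff entrywise add)
    show "\<Delta>' (x ** y) = \<Delta>' x ** y + x ** \<Delta>' y"
      by (simp add: vec_eq_iff entrywise matrix_matrix_mult_def entry_map_sum mult sum.distrib)
    \<comment> \<open>Homogeneity concerns only the pair x and c x, so it is inherited from a single
      \<open>ad h\<close>.\<close>
    from two_local_innerE[OF inner] obtain h
      where "\<Delta>' x = ad h x" "\<Delta>' (scaleC_mat c x) = ad h (scaleC_mat c x)" .
    then show "\<Delta>' (scaleC_mat c x) = scaleC_mat c (\<Delta>' x)"
      using derivation_ad[of h] by (simp add: derivation_mat_iff)
  qed
  then have "derivation scaleC_mat (**) (\<lambda>x. \<Delta>' x + ad g x)"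
    by (rule derivation_mat_add) (rule derivation_ad)
  then show ?thesis by (simp add: \<Delta>'_def)
qed

end
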